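(* Let $n,r$ be positive integers. The image of $\Phi:\mathbb{R}^{n\times r}\to\mathbb{R}^K$ is the zero set of the single nonnegative tropical rational function $\min_{\vec\sigma}D_{\vec\sigma}$: $$\Phi(\mathbb{R}^{n\times r})=\Bigl\{w\in\mathbb{R}^K : \min_{\vec\sigma\in S_n^{\,r-1}}D_{\vec\sigma}(w)=0\Bigr\},$$ and this set is a finite union of polyhedra.
   Context: $\mathbb{N}=\{0,1,2,\dots\}$. For $M=(m_{i\alpha})\in\mathbb{R}^{n\times r}$ and $c\in\mathbb{N}^r$ with $0<|c|:=c_1+\cdots+c_r\le n$, the basic value is $$b_c(M)=\max\Bigl\{\sum_{\alpha=1}^r\sum_{i\in I_\alpha} m_{i\alpha} : I_1,\dots,I_r\subseteq\{1,\dots,n\}\text{ pairwise disjoint},\ \#I_\alpha=c_\alpha\Bigr\},$$ and $b_0=0$. Put $K=\binom{n+r}{r}-1$ and $\Phi=(b_c)_{0<|c|\le n}:\mathbb{R}^{n\times r}\to\mathbb{R}^K$; coordinates of $w\in\mathbb{R}^K$ are written $w_c$, $0<|c|\le n$, and $w_0:=0$. The map $s:\mathbb{R}^K\to\mathbb{R}^{n\times r}$ is $s(w)_{i\alpha}:=w_{ie_\alpha}-w_{(i-1)e_\alpha}$, with $e_\alpha$ the $\alpha$th standard basis vector of $\mathbb{N}^r$. For $\vec\sigma=(\sigma_2,\dots,\sigma_r)\in S_n^{\,r-1}$ and $U\in\mathbb{R}^{n\times r}$ with columns $U^{(1)},\dots,U^{(r)}$, $R_{\vec\sigma}(U)$ is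 the matrix whose $i$th row is $(U^{(1)}_i,U^{(2)}_{\sigma_2(i)},\dots,U^{(r)}_{\sigma_r(i)})$. The recoupling discriminant is $D_{\vec\sigma}(w):=\max_{0<|c|\le n}|w_c-b_c(R_{\vec\sigma}(s(w)))|$. A tropical polynomial on $\mathbb{R}^m$ is a finite maximum of functions $z\mapsto\gamma+\sum_i a_iz_i$ with $\gamma\in\mathbb{R}$, $a\in\mathbb{Z}_{\ge0}^m$; a tropical rational function is a difference of two tropical polynomials, regarded as a function. A polyhedron is a finite intersection of closed half-spaces. *)

theory Defs
  imports "HOL-Analysis.Analysis"
begin

text \<open>The numbers \<open>n\<close> and \<open>r\<close> are the cardinalities of the linearly ordered finite index types
  \<open>'n\<close> and \<open>'r\<close>. An \<open>n \<times> r\<close> matrix has type \<open>real^'r^'n\<close>, so \<open>M $ i $ \<alpha>\<close> is its entry in row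
  \<open>i\<close> and column \<open>\<alpha>\<close>.\<close>

text \<open>The type \<open>('n, 'r) cidx\<close> of exponents \<open>c\<close> with \<open>0 < |c| \<le> n\<close> indexes the coordinates of
  \<open>\<real>\<^sup>K\<close>, which is therefore \<open>real^('n, 'r) cidx\<close>; \<open>card_cidx\<close> below gives the value of \<open>K\<close>.\<close>

typedef ('n::finite, 'r::finite) cidx =
  "{c :: 'r \<Rightarrow> nat. 0 < (\<Sum>\<alpha>\<in>UNIV. c \<alpha>) \<and> (\<Sum>\<alpha>\<in>UNIV. c \<alpha>) \<le> CARD('n)}"
proof
  fix \<alpha> :: 'r
  show "(\<lambda>\<beta>. if \<beta> = \<alpha> then 1 else 0) \<in>
      {c :: 'r \<Rightarrow> nat. 0 < (\<Sum>\<alpha>\<in>UNIV. c \<alpha>) \<and> (\<Sum>\<alpha>\<in>UNIV. c \<alpha>) \<le> CARD('n)}"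
    by (simp add: Suc_leI)
qed

lemma card_sum_le:
  fixes n :: nat
  shows "card {c :: 'r::finite \<Rightarrow> nat. (\<Sum>\<alpha>\<in>UNIV. c \<alpha>) \<le> n} = (n + CARD('r)) choose CARD('r)"
    (is "card ?A = _")
proof -
  let ?r = "CARD('r)"
  let ?L = "{l :: nat list. length l = Suc ?r \<and> sum_list l = n}"
  obtain h :: "nat \<Rightarrow> 'r" where h: "bij_betw h {0..<?r} UNIV"
    using ex_bij_betw_nat_finite[of "UNIV :: 'r set"] by auto
  have sum_h: "(\<Sum>\<alpha>\<in>UNIV. c \<alpha>) = sum_list (map (c \<circ> h) [0..<?r])" for c :: "'r \<Rightarrow> nat"
    using sum.reindex_bij_betw[OF h, of c] by (simp add: interv_sum_list_conv_sum_set_nat)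
  define f where "f c = (n - (\<Sum>\<alpha>\<in>UNIV. c \<alpha>)) # map (c \<circ> h) [0..<?r]" for c :: "'r \<Rightarrow> nat"
  define g where "g l = (\<lambda>\<alpha>. l ! Suc (inv_into {0..<?r} h \<alpha>))" for l :: "nat list"
  have hinv: "inv_into {0..<?r} h \<alpha> < ?r" "h (inv_into {0..<?r} h \<alpha>) = \<alpha>" for \<alpha>
    using h inv_into_into[of \<alpha> h "{0..<?r}"] f_inv_into_f[of \<alpha> h "{0..<?r}"]
    by (auto simp: bij_betw_def)
  have invh: "inv_into {0..<?r} h (h i) = i" if "i < ?r" for i
    using h that by (auto simp: bij_betw_def)
  have gf: "g (f c) = c" for c
    by (rule ext) (simp add: f_def g_def hinv)
  have tl: "map (g l \<circ> h) [0..<?r] = tl l" if "length l = Suc ?r" for l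
    by (rule nth_equalityI) (use that in \<open>auto simp: g_def invh nth_tl\<close>)
  have g: "g l \<in> ?A \<and> f (g l) = l" if lL: "l \<in> ?L" for l
  proof -
    obtain x xs where l: "l = x # xs" using lL by (cases l) auto
    have "(\<Sum>\<alpha>\<in>UNIV. g l \<alpha>) = sum_list xs"
      using sum_h[of "g l"] tl[of l] lL l by simp
    then show ?thesis using lL l tl[of l] by (auto simp: f_def)
  qed
  have "f c \<in> ?L" if "c \<in> ?A" for c
    using that sum_h[of c] by (simp add: f_def)
  then have "bij_betw f ?A ?L"
    by (intro bij_betwI[of _ _ _ g]) (use g gf in auto)
  then have "card ?A = card ?L" by (rule bij_betw_same_card)
  also have "\<dots> = (n + ?r) choose n"
    using card_length_sum_list[of "Suc ?r" n] by simp
  also have "\<dots> = (n + ?r) choose ?r"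
    using binomial_symmetric[of n "n + ?r"] by simp
  finally show ?thesis .
qed

lemma finite_sum_le: "finite {c :: 'r::finite \<Rightarrow> nat. (\<Sum>\<alpha>\<in>UNIV. c \<alpha>) \<le> n}"
  by (rule card_ge_0_finite) (simp add: card_sum_le)

instance cidx :: (finite, finite) finite
proof
  have "finite {c :: 'b \<Rightarrow> nat. 0 < (\<Sum>\<alpha>\<in>UNIV. c \<alpha>) \<and> (\<Sum>\<alpha>\<in>UNIV. c \<alpha>) \<le> CARD('a)}"
    by (rule finite_subset[OF _ finite_sum_le[of "CARD('a)"]]) auto
  then show "finite (UNIV :: ('a, 'b) cidx set)"
    unfolding type_definition.univ[OF type_definition_cidx] by (rule finite_imageI)
qed

lemma card_cidx:
  "CARD(('n::finite, 'r::finite) cidx) = ((CARD('n) + CARD('r)) choose CARD('r)) - 1"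
proof -
  let ?A = "{c :: 'r \<Rightarrow> nat. (\<Sum>\<alpha>\<in>UNIV. c \<alpha>) \<le> CARD('n)}"
  have "CARD(('n, 'r) cidx)
      = card {c :: 'r \<Rightarrow> nat. 0 < (\<Sum>\<alpha>\<in>UNIV. c \<alpha>) \<and> (\<Sum>\<alpha>\<in>UNIV. c \<alpha>) \<le> CARD('n)}"
    by (rule type_definition.card[OF type_definition_cidx])
  also have "{c :: 'r \<Rightarrow> nat. 0 < (\<Sum>\<alpha>\<in>UNIV. c \<alpha>) \<and> (\<Sum>\<alpha>\<in>UNIV. c \<alpha>) \<le> CARD('n)} = ?A - {\<lambda>_. 0}"
    by (auto simp: fun_eq_iff intro: Nat.gr0I)
  also have "card \<dots> = card ?A - 1"
    by (rule card_Diff_singleton) simp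
  finally show ?thesis by (simp add: card_sum_le)
qed

definition basic_value :: "('r \<Rightarrow> nat) \<Rightarrow> real^'r^'n \<Rightarrow> real" where
  "basic_value c M = Max {(\<Sum>\<alpha>\<in>UNIV. \<Sum>i\<in>I \<alpha>. M $ i $ \<alpha>) |I :: 'r \<Rightarrow> 'n set.
     disjoint_family I \<and> (\<forall>\<alpha>. card (I \<alpha>) = c \<alpha>)}"

definition Phi :: "real^'r^'n \<Rightarrow> real^('n, 'r) cidx" where
  "Phi M = (\<chi> c. basic_value (Rep_cidx c) M)"

text \<open>The coordinate \<open>w\<^sub>c\<close>, with the convention \<open>w\<^sub>0 = 0\<close>; it is only meaningful for \<open>|c| \<le> n\<close>.\<close>

definition coord :: "real^('n::finite, 'r::finite) cidx \<Rightarrow> ('r \<Rightarrow> nat) \<Rightarrow> real" where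
  "coord w c = (if c = (\<lambda>_. 0) then 0 else w $ Abs_cidx c)"

definition scaled_unit :: "nat \<Rightarrow> 'r \<Rightarrow> ('r \<Rightarrow> nat)" where
  "scaled_unit k \<alpha> = (\<lambda>\<beta>. if \<beta> = \<alpha> then k else 0)"

text \<open>The position, in \<open>{1..n}\<close>, of a row index.\<close>

definition row_number :: "'n::{finite,linorder} \<Rightarrow> nat" where
  "row_number i = card {..i}"

definition section_map :: "real^('n::{finite,linorder}, 'r::finite) cidx \<Rightarrow> real^'r^'n::{finite,linorder}" where
  "section_map w = (\<chi> i \<alpha>.
     coord w (scaled_unit (row_number i) \<alpha>) - coord w (scaled_unit (row_number i - 1) \<alpha>))"

text \<open>A tuple \<open>(\<sigma>\<^sub>2, \<dots>, \<sigma>\<^sub>r)\<close> of permutations of the rows is extended by \<open>\<sigma>\<^sub>1 = id\<close> for the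
  first column, \<open>Min UNIV\<close>.\<close>

definition recouplings :: "('r::{finite,linorder} \<Rightarrow> 'n \<Rightarrow> 'n) set" where
  "recouplings = {\<sigma>. (\<forall>\<alpha>. bij (\<sigma> \<alpha>)) \<and> \<sigma> (Min UNIV) = id}"

definition recouple :: "('r \<Rightarrow> 'n \<Rightarrow> 'n) \<Rightarrow> real^'r^'n \<Rightarrow> real^'r^'n" where
  "recouple \<sigma> U = (\<chi> i \<alpha>. U $ \<sigma> \<alpha> i $ \<alpha>)"

definition discriminant ::
    "('r::finite \<Rightarrow> 'n \<Rightarrow> 'n) \<Rightarrow> real^('n::{finite,linorder}, 'r) cidx \<Rightarrow> real" where
  "discriminant \<sigma> w = (MAX c. \<bar>w $ c - basic_value (Rep_cidx c) (recouple \<sigma> (section_map w))\<bar>)"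

definition min_discriminant ::
    "real^('n::{finite,linorder}, 'r::{finite,linorder}) cidx \<Rightarrow> real" where
  "min_discriminant w = (MIN \<sigma>\<in>recouplings. discriminant \<sigma> w)"

definition tropical_polynomial :: "(real^'m \<Rightarrow> real) \<Rightarrow> bool" where
  "tropical_polynomial f \<longleftrightarrow> (\<exists>T :: (real \<times> ('m \<Rightarrow> nat)) set. finite T \<and> T \<noteq> {} \<and>
     (\<forall>z. f z = (MAX (\<gamma>, a)\<in>T. \<gamma> + (\<Sum>i\<in>UNIV. real (a i) * z $ i))))"

definition tropical_rational :: "(real^'m \<Rightarrow> real) \<Rightarrow> bool" where
  "tropical_rational f \<longleftrightarrow>
     (\<exists>p q. tropical_polynomial p \<and> tropical_polynomial q \<and> (\<forall>z. f z = p z - q z))"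

end

theory Submission
  imports Defs
begin

text \<open>The basic values of weight concentrated in one column \<open>\<alpha>\<close> are the sums of the \<open>k\<close> largest
  entries of that column, so their successive differences list the column in decreasing order:
  \<open>section_map (Phi M)\<close> is \<open>M\<close> with every column sorted (\<open>section_map_Phi\<close>). Hence \<open>M\<close> arises from
  \<open>section_map (Phi M)\<close> by permuting each column separately. Basic values do not change when the
  rows of a matrix are permuted simultaneously (\<open>basic_value_permute_rows\<close>), so the permutation of
  the first column can be taken to be the identity, which leaves a recoupling \<open>\<sigma>\<close> with
  \<open>Phi M = Phi (recouple \<sigma> (section_map (Phi M)))\<close>. So \<open>w\<close> lies in the image of \<open>Phi\<close> exactly if
  one of the finitely many candidates \<open>recouple \<sigma> (section_map w)\<close> is a preimage, that is, if one
  of the nonnegative discriminants vanishes at \<open>w\<close>.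

  The tropical rational functions contain the coordinates and are closed under sums, negation,
  maxima and minima, and \<open>min_discriminant\<close> is built from coordinates by these operations.
  Finally, the zero set of any tropical rational function is a finite union of polyhedra: split it
  according to which terms attain the two maxima (\<open>tropical_rational_zero_set\<close>).\<close>

section \<open>Tropical polynomials and rational functions\<close>

definition term_value :: "real \<times> ('m::finite \<Rightarrow> nat) \<Rightarrow> real^'m \<Rightarrow> real" where
  "term_value t z = fst t + (\<Sum>i\<in>UNIV. real (snd t i) * z $ i)"

text \<open>As an attained upper bound, the maximum enters sums, binary maxima and zero sets through
  inequalities between single terms. That it is attained also encodes \<open>T \<noteq> {}\<close>.\<close>

lemma tropical_polynomial_iff:
  "tropical_polynomial f \<longleftrightarrow> (\<exists>T. finite T \<and>
     (\<forall>z. (\<forall>t\<in>T. term_value t z \<le> f z) \<and> (\<exists>t\<in>T. f z = term_value t z)))"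
proof -
  have "(MAX (\<gamma>, a)\<in>T. \<gamma> + (\<Sum>i\<in>UNIV. real (a i) * z $ i)) = (MAX t\<in>T. term_value t z)"
    for T and z :: "real^'a"
    by (simp add: term_value_def case_prod_beta)
  moreover have "T \<noteq> {} \<and> (\<forall>z. f z = (MAX t\<in>T. term_value t z)) \<longleftrightarrow>
      (\<forall>z. (\<forall>t\<in>T. term_value t z \<le> f z) \<and> (\<exists>t\<in>T. f z = term_value t z))"
    if "finite T" for T
  proof (cases "T = {}")
    case False
    have "f z = (MAX t\<in>T. term_value t z) \<longleftrightarrow>
        (\<forall>t\<in>T. term_value t z \<le> f z) \<and> (\<exists>t\<in>T. f z = term_value t z)" for z
      using that False by (subst eq_commute, subst Max_eq_iff) auto
    with False show ?thesis by simp
  qed simp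
  ultimately show ?thesis
    unfolding tropical_polynomial_def by (simp cong: conj_cong)
qed

lemma tropical_polynomialE:
  assumes "tropical_polynomial f"
  obtains T where "finite T" "\<And>z t. t \<in> T \<Longrightarrow> term_value t z \<le> f z"
    "\<And>z. \<exists>t\<in>T. f z = term_value t z"
proof -
  obtain T where "finite T"
    "\<forall>z. (\<forall>t\<in>T. term_value t z \<le> f z) \<and> (\<exists>t\<in>T. f z = term_value t z)"
    using assms unfolding tropical_polynomial_iff by (elim exE conjE)
  then show thesis using that[of T] by blast
qed

lemma tropical_polynomial_affine:
  "tropical_polynomial (\<lambda>z. \<gamma> + (\<Sum>i\<in>UNIV. real (a i) * z $ i))"
  unfolding tropical_polynomial_iff
  by (intro exI[of _ "{(\<gamma>, a)}"]) (simp add: term_value_def)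

lemma tropical_polynomial_const: "tropical_polynomial (\<lambda>_. \<gamma>)"
  using tropical_polynomial_affine[of \<gamma> "\<lambda>_. 0"] by simp

lemma tropical_polynomial_coordinate: "tropical_polynomial (\<lambda>z. z $ i)"
proof -
  have "(\<Sum>j\<in>UNIV. real (if j = i then 1 else 0) * z $ j)
      = (\<Sum>j\<in>UNIV. if j = i then z $ j else 0)" for z :: "real^'a"
    by (rule sum.cong) auto
  then show ?thesis
    using tropical_polynomial_affine[of 0 "\<lambda>j. if j = i then 1 else 0"] by simp
qed

lemma tropical_polynomial_max:
  assumes "tropical_polynomial f" "tropical_polynomial g"
  shows "tropical_polynomial (\<lambda>z. max (f z) (g z))"
proof -
  obtain S where S: "finite S" "\<And>z t. t \<in> S \<Longrightarrow> term_value t z \<le> f z"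
      "\<And>z. \<exists>t\<in>S. f z = term_value t z"
    by (rule tropical_polynomialE[OF assms(1)]) (rule that)
  obtain T where T: "finite T" "\<And>z t. t \<in> T \<Longrightarrow> term_value t z \<le> g z"
      "\<And>z. \<exists>t\<in>T. g z = term_value t z"
    by (rule tropical_polynomialE[OF assms(2)]) (rule that)
  have "\<exists>t\<in>S \<union> T. max (f z) (g z) = term_value t z" for z
    unfolding max_def using S(3)[of z] T(3)[of z] by (cases "f z \<le> g z") (simp_all, blast+)
  moreover have "term_value t z \<le> max (f z) (g z)" if "t \<in> S \<union> T" for t z
    using that S(2)[of t z] T(2)[of t z] by auto
  ultimately show ?thesis
    unfolding tropical_polynomial_iff using S(1) T(1) by (intro exI[of _ "S \<union> T"]) simp
qed

text \<open>The sum of two maxima is the maximum over all pairs of terms, and adding two terms adds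
  their exponents.\<close>

lemma tropical_polynomial_add:
  assumes "tropical_polynomial f" "tropical_polynomial g"
  shows "tropical_polynomial (\<lambda>z. f z + g z)"
proof -
  obtain S where S: "finite S" "\<And>z t. t \<in> S \<Longrightarrow> term_value t z \<le> f z"
      "\<And>z. \<exists>t\<in>S. f z = term_value t z"
    by (rule tropical_polynomialE[OF assms(1)]) (rule that)
  obtain T where T: "finite T" "\<And>z t. t \<in> T \<Longrightarrow> term_value t z \<le> g z"
      "\<And>z. \<exists>t\<in>T. g z = term_value t z"
    by (rule tropical_polynomialE[OF assms(2)]) (rule that)
  define add where "add = (\<lambda>(s, t). (fst s + fst t :: real, \<lambda>i::'a. snd s i + snd t i :: nat))"
  have val: "term_value (add (s, t)) z = term_value s z + term_value t z" for s t z
    by (simp add: add_def term_value_def distrib_right sum.distrib)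
  show ?thesis
    unfolding tropical_polynomial_iff
  proof (intro exI[of _ "add ` (S \<times> T)"] conjI allI)
    fix z
    show "\<forall>t\<in>add ` (S \<times> T). term_value t z \<le> f z + g z"
      by (auto simp: val intro: add_mono S T)
    obtain s t where "s \<in> S" "f z = term_value s z" "t \<in> T" "g z = term_value t z"
      using S(3)[of z] T(3)[of z] by blast
    then show "\<exists>t\<in>add ` (S \<times> T). f z + g z = term_value t z"
      by (intro bexI[of _ "add (s, t)"]) (auto simp: val)
  qed (use S(1) T(1) in simp)
qed

lemma tropical_rational_polynomial: "tropical_polynomial p \<Longrightarrow> tropical_rational p"
  unfolding tropical_rational_def using tropical_polynomial_const[of 0] by force

lemma tropical_rational_uminus:
  assumes "tropical_rational f"
  shows "tropical_rational (\<lambda>z. - f z)"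
proof -
  obtain p q where "tropical_polynomial p" "tropical_polynomial q" "\<And>z. f z = p z - q z"
    using assms unfolding tropical_rational_def by blast
  then show ?thesis
    unfolding tropical_rational_def by (intro exI[of _ q] exI[of _ p]) simp
qed

lemma tropical_rational_add:
  assumes "tropical_rational f" "tropical_rational g"
  shows "tropical_rational (\<lambda>z. f z + g z)"
proof -
  obtain p q p' q' where "tropical_polynomial p" "tropical_polynomial q" "\<And>z. f z = p z - q z"
    "tropical_polynomial p'" "tropical_polynomial q'" "\<And>z. g z = p' z - q' z"
    using assms unfolding tropical_rational_def by metis
  then show ?thesis
    unfolding tropical_rational_def
    by (intro exI[of _ "\<lambda>z. p z + p' z"] exI[of _ "\<lambda>z. q z + q' z"])
       (simp add: tropical_polynomial_add)
qed

text \<open>Adding \<open>q + q'\<close> to \<open>p - q\<close> and to \<open>p' - q'\<close> clears the denominators inside the maximum.\<close>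

lemma tropical_rational_max:
  assumes "tropical_rational f" "tropical_rational g"
  shows "tropical_rational (\<lambda>z. max (f z) (g z))"
proof -
  obtain p q p' q' where "tropical_polynomial p" "tropical_polynomial q" "\<And>z. f z = p z - q z"
    "tropical_polynomial p'" "tropical_polynomial q'" "\<And>z. g z = p' z - q' z"
    using assms unfolding tropical_rational_def by metis
  moreover from this have
    "max (f z) (g z) = max (p z + q' z) (p' z + q z) - (q z + q' z)" for z
    by (simp add: max_def)
  ultimately show ?thesis
    unfolding tropical_rational_def
    by (intro exI[of _ "\<lambda>z. max (p z + q' z) (p' z + q z)"] exI[of _ "\<lambda>z. q z + q' z"])
       (simp add: tropical_polynomial_add tropical_polynomial_max)
qed

lemma tropical_rational_diff:
  assumes "tropical_rational f" "tropical_rational g"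
  shows "tropical_rational (\<lambda>z. f z - g z)"
  using tropical_rational_add[OF assms(1) tropical_rational_uminus[OF assms(2)]] by simp

lemma tropical_rational_abs:
  assumes "tropical_rational f"
  shows "tropical_rational (\<lambda>z. \<bar>f z\<bar>)"
proof -
  have "\<bar>f z\<bar> = max (f z) (- f z)" for z by (simp add: max_def)
  then show ?thesis
    using tropical_rational_max[OF assms tropical_rational_uminus[OF assms]] by simp
qed

lemma tropical_rational_min:
  assumes "tropical_rational f" "tropical_rational g"
  shows "tropical_rational (\<lambda>z. min (f z) (g z))"
proof -
  have "min (f z) (g z) = - max (- f z) (- g z)" for z by (simp add: max_def min_def)
  then show ?thesis
    using assms by (simp add: tropical_rational_uminus tropical_rational_max)
qed

lemma tropical_rational_sum:
  assumes "\<And>j. j \<in> S \<Longrightarrow> tropical_rational (f j)"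
  shows "tropical_rational (\<lambda>z. \<Sum>j\<in>S. f j z)"
  using assms
proof (induction S rule: infinite_finite_induct)
  case (insert j S)
  then show ?case by (simp add: tropical_rational_add)
qed (simp_all add: tropical_rational_polynomial tropical_polynomial_const)

lemma tropical_rational_Max:
  assumes "finite S" "S \<noteq> {}" "\<And>j. j \<in> S \<Longrightarrow> tropical_rational (f j)"
  shows "tropical_rational (\<lambda>z. MAX j\<in>S. f j z)"
  using assms
  by (induction S rule: finite_ne_induct) (simp_all add: tropical_rational_max)

lemma tropical_rational_Min:
  assumes "finite S" "S \<noteq> {}" "\<And>j. j \<in> S \<Longrightarrow> tropical_rational (f j)"
  shows "tropical_rational (\<lambda>z. MIN j\<in>S. f j z)"
  using assms
  by (induction S rule: finite_ne_induct) (simp_all add: tropical_rational_min)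

lemma polyhedron_term_value_le: "polyhedron {z. term_value s z \<le> term_value t z}"
proof -
  define a :: "real^'a" where "a = (\<chi> i. real (snd s i) - real (snd t i))"
  have "term_value s z \<le> term_value t z \<longleftrightarrow> a \<bullet> z \<le> fst t - fst s" for z
    by (auto simp: a_def term_value_def inner_vec_def left_diff_distrib sum_subtractf)
  then show ?thesis
    by (simp add: polyhedron_halfspace_le)
qed

text \<open>Where the term \<open>s\<close> attains the maximum \<open>p\<close> and the term \<open>t\<close> the maximum \<open>q\<close>, the equation
  \<open>p = q\<close> reads \<open>s = t\<close>. The region in which this happens is cut out by finitely many
  inequalities between terms, and the regions for all pairs \<open>(s, t)\<close> cover the zero set of
  \<open>p - q\<close>.\<close>

lemma tropical_rational_zero_set:
  fixes f :: "real^'m \<Rightarrow> real"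
  assumes "tropical_rational f"
  shows "\<exists>\<P>. finite \<P> \<and> (\<forall>P\<in>\<P>. polyhedron P) \<and> {z. f z = 0} = \<Union>\<P>"
proof -
  obtain p q where pq: "tropical_polynomial p" "tropical_polynomial q" "\<And>z. f z = p z - q z"
    using assms unfolding tropical_rational_def by blast
  obtain S where S: "finite S" "\<And>z t. t \<in> S \<Longrightarrow> term_value t z \<le> p z"
      "\<And>z. \<exists>t\<in>S. p z = term_value t z"
    by (rule tropical_polynomialE[OF pq(1)]) (rule that)
  obtain T where T: "finite T" "\<And>z t. t \<in> T \<Longrightarrow> term_value t z \<le> q z"
      "\<And>z. \<exists>t\<in>T. q z = term_value t z"
    by (rule tropical_polynomialE[OF pq(2)]) (rule that)
  define le where "le u v = {z :: real^'m. term_value u z \<le> term_value v z}" for u v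
  define region where "region = (\<lambda>(s, t).
    \<Inter>((\<lambda>u. le u s) ` S \<union> (\<lambda>u. le u t) ` T \<union> {le s t, le t s}))"
  have poly: "polyhedron (region x)" for x
    unfolding region_def le_def using S(1) T(1)
    by (cases x) (auto intro!: polyhedron_Inter simp: polyhedron_term_value_le
        simp del: Inter_insert Un_insert_right)
  have mem: "z \<in> region (s, t) \<longleftrightarrow> (\<forall>u\<in>S. term_value u z \<le> term_value s z) \<and>
      (\<forall>u\<in>T. term_value u z \<le> term_value t z) \<and> term_value s z = term_value t z" for s t z
    by (auto simp: region_def le_def)
  have "{z. f z = 0} = (\<Union>x\<in>S \<times> T. region x)"
  proof (intro equalityI subsetI)
    fix z assume "z \<in> {z. f z = 0}"
    then have eq: "p z = q z" using pq(3) by simp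
    obtain s t where "s \<in> S" "p z = term_value s z" "t \<in> T" "q z = term_value t z"
      using S(3)[of z] T(3)[of z] by blast
    moreover from this have "z \<in> region (s, t)"
      unfolding mem using S(2)[of _ z] T(2)[of _ z] eq by metis
    ultimately show "z \<in> (\<Union>x\<in>S \<times> T. region x)" by blast
  next
    fix z assume "z \<in> (\<Union>x\<in>S \<times> T. region x)"
    then obtain s t where st: "s \<in> S" "t \<in> T" "z \<in> region (s, t)" by auto
    obtain s' t' where st': "s' \<in> S" "p z = term_value s' z" "t' \<in> T" "q z = term_value t' z"
      using S(3)[of z] T(3)[of z] by blast
    have "p z = term_value s z" "q z = term_value t z"
      using st st' S(2)[of s z] T(2)[of t z] unfolding mem by (metis order.antisym)+
    then show "z \<in> {z. f z = 0}" using st(3) pq(3) unfolding mem by simp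
  qed
  then show ?thesis
    using S(1) T(1) poly by (intro exI[of _ "region ` (S \<times> T)"]) simp
qed

section \<open>Basic values\<close>

text \<open>This makes the maximum that defines \<open>basic_value\<close> range over a nonempty set: the parts are
  chosen one after the other, and the bound on the sum leaves enough rows for the next part.\<close>

lemma ex_disjoint_family_card:
  fixes c :: "'r \<Rightarrow> nat"
  assumes "finite A" "(\<Sum>\<alpha>\<in>A. c \<alpha>) \<le> CARD('n::finite)"
  shows "\<exists>I :: 'r \<Rightarrow> 'n set. disjoint_family_on I A \<and> (\<forall>\<alpha>\<in>A. card (I \<alpha>) = c \<alpha>)"
  using assms
proof (induction A rule: finite_induct)
  case (insert \<alpha> A)
  then obtain I :: "'r \<Rightarrow> 'n set" where I: "disjoint_family_on I A" "\<forall>\<beta>\<in>A. card (I \<beta>) = c \<beta>"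
    by auto
  have "card (\<Union>(I ` A)) \<le> (\<Sum>\<beta>\<in>A. c \<beta>)"
    using card_UN_le[OF insert.hyps(1), of I] I(2) by simp
  then have "c \<alpha> \<le> card (- \<Union>(I ` A))"
    using insert by (simp add: Compl_eq_Diff_UNIV card_Diff_subset)
  then obtain J where J: "J \<subseteq> - \<Union>(I ` A)" "card J = c \<alpha>"
    by (meson obtain_subset_with_card_n)
  have upd: "(I(\<alpha> := J)) \<beta> = I \<beta>" if "\<beta> \<in> A" for \<beta>
    using that insert.hyps(2) by auto
  have "disjoint_family_on (I(\<alpha> := J)) A"
    using I(1) upd by (simp add: disjoint_family_on_def)
  moreover have "J \<inter> \<Union>((I(\<alpha> := J)) ` A) = {}"
    using J(1) upd by auto
  ultimately have "disjoint_family_on (I(\<alpha> := J)) (insert \<alpha> A)"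
    using insert.hyps(2) by (simp add: disjoint_family_on_insert)
  moreover have "\<forall>\<beta>\<in>insert \<alpha> A. card ((I(\<alpha> := J)) \<beta>) = c \<beta>"
    using I(2) J(2) upd by auto
  ultimately show ?case by blast
qed (simp add: disjoint_family_on_def)

lemma tropical_rational_basic_value:
  fixes F :: "real^'m \<Rightarrow> real^'r^'n" and c :: "('n, 'r) cidx"
  assumes "\<And>i \<alpha>. tropical_rational (\<lambda>w. F w $ i $ \<alpha>)"
  shows "tropical_rational (\<lambda>w. basic_value (Rep_cidx c) (F w))"
proof -
  let ?A = "{I :: 'r \<Rightarrow> 'n set. disjoint_family I \<and> (\<forall>\<alpha>. card (I \<alpha>) = Rep_cidx c \<alpha>)}"
  have "(\<Sum>\<alpha>\<in>UNIV. Rep_cidx c \<alpha>) \<le> CARD('n)"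
    using Rep_cidx[of c] by simp
  then have "?A \<noteq> {}"
    using ex_disjoint_family_card[of UNIV "Rep_cidx c", where ?'n = 'n] by auto
  then show ?thesis
    unfolding basic_value_def setcompr_eq_image
    by (intro tropical_rational_Max tropical_rational_sum assms) auto
qed

text \<open>Permuting the rows carries the admissible families \<open>I\<close> bijectively onto each other.\<close>

lemma basic_value_permute_rows:
  fixes M :: "real^'r^'n" and \<pi> :: "'n \<Rightarrow> 'n"
  assumes "bij \<pi>"
  shows "basic_value c (\<chi> i. M $ \<pi> i) = basic_value c M"
proof -
  let ?A = "{I :: 'r \<Rightarrow> 'n set. disjoint_family I \<and> (\<forall>\<alpha>. card (I \<alpha>) = c \<alpha>)}"
  let ?v = "\<lambda>(N :: real^'r^'n) I. \<Sum>\<alpha>\<in>UNIV. \<Sum>i\<in>I \<alpha>. N $ i $ \<alpha>"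
  have closed: "(\<lambda>\<alpha>. \<rho> ` I \<alpha>) \<in> ?A" if "I \<in> ?A" "bij \<rho>" for I and \<rho> :: "'n \<Rightarrow> 'n"
  proof -
    have inj: "inj \<rho>" using that(2) by (rule bij_is_inj)
    have "disjoint_family (\<lambda>\<alpha>. \<rho> ` I \<alpha>)"
      using that(1) inj by (auto simp: disjoint_family_on_def image_Int[symmetric])
    then show ?thesis
      using that(1) inj by (simp add: card_image inj_on_subset)
  qed
  have val: "?v (\<chi> i. M $ \<pi> i) I = ?v M (\<lambda>\<alpha>. \<pi> ` I \<alpha>)" for I
    using bij_is_inj[OF assms] by (simp add: sum.reindex inj_on_subset)
  have "(\<lambda>I \<alpha>. \<pi> ` I \<alpha>) ` ?A = ?A"
  proof (intro equalityI subsetI)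
    fix I assume I: "I \<in> ?A"
    have "I = (\<lambda>\<alpha>. \<pi> ` inv \<pi> ` I \<alpha>)"
      using assms by (simp add: image_f_inv_f bij_is_surj)
    then show "I \<in> (\<lambda>I \<alpha>. \<pi> ` I \<alpha>) ` ?A"
      using closed[OF I bij_imp_bij_inv[OF assms]] by (rule image_eqI)
  qed (use closed assms in blast)
  then have "?v (\<chi> i. M $ \<pi> i) ` ?A = ?v M ` ?A"
    unfolding val image_image[symmetric, of "?v M" "\<lambda>I \<alpha>. \<pi> ` I \<alpha>"] by simp
  then show ?thesis
    unfolding basic_value_def setcompr_eq_image by simp
qed

text \<open>Exchanging the elements of \<open>B - A\<close> for those of \<open>A - B\<close> does not decrease the sum.\<close>

lemma sum_le_sum_dominating:
  fixes f :: "'a \<Rightarrow> real"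
  assumes "finite A" "finite B" "card A = card B" "\<And>a b. a \<in> A \<Longrightarrow> b \<notin> A \<Longrightarrow> f b \<le> f a"
  shows "sum f B \<le> sum f A"
proof -
  have "card (B - A) = card (A - B)"
    using assms(1-3) by (simp add: card_Diff_subset_Int Int_commute)
  then obtain h where h: "bij_betw h (B - A) (A - B)"
    using assms(1,2) by (metis finite_Diff finite_same_card_bij)
  have "sum f (B - A) \<le> (\<Sum>b\<in>B - A. f (h b))"
    using h assms(4) by (intro sum_mono) (auto dest: bij_betwE)
  also have "\<dots> = sum f (A - B)"
    using h by (rule sum.reindex_bij_betw)
  finally show ?thesis
    using sum.Int_Diff[OF assms(1), of f B] sum.Int_Diff[OF assms(2), of f A]
    by (simp add: Int_commute)
qed

text \<open>At \<open>k e\<^sub>\<alpha>\<close> all parts of an admissible family except the one for \<open>\<alpha>\<close> are empty, so the maximum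
  runs over the choices of \<open>k\<close> rows in column \<open>\<alpha>\<close>, and \<open>A\<close> is an optimal choice.\<close>

lemma basic_value_scaled_unit:
  fixes M :: "real^'r^'n"
  assumes "\<And>a b. a \<in> A \<Longrightarrow> b \<notin> A \<Longrightarrow> M $ b $ \<alpha> \<le> M $ a $ \<alpha>"
  shows "basic_value (scaled_unit (card A) \<alpha>) M = (\<Sum>i\<in>A. M $ i $ \<alpha>)"
proof -
  let ?P = "\<lambda>I :: 'r \<Rightarrow> 'n set. disjoint_family I \<and> (\<forall>\<beta>. card (I \<beta>) = scaled_unit (card A) \<alpha> \<beta>)"
  let ?v = "\<lambda>I. \<Sum>\<beta>\<in>UNIV. \<Sum>i\<in>I \<beta>. M $ i $ \<beta>"
  have val: "?v I = (\<Sum>i\<in>I \<alpha>. M $ i $ \<alpha>)" if "?P I" for I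
  proof -
    have "I \<beta> = {}" if "\<beta> \<noteq> \<alpha>" for \<beta>
      using \<open>?P I\<close> that by (metis card_0_eq finite scaled_unit_def)
    then have "?v I = (\<Sum>\<beta>\<in>{\<alpha>}. \<Sum>i\<in>I \<beta>. M $ i $ \<beta>)"
      by (intro sum.mono_neutral_right) auto
    then show ?thesis by simp
  qed
  define I\<^sub>0 where "I\<^sub>0 \<beta> = (if \<beta> = \<alpha> then A else {})" for \<beta>
  have I\<^sub>0: "?P I\<^sub>0" by (auto simp: I\<^sub>0_def scaled_unit_def disjoint_family_on_def)
  have "Max (?v ` {I. ?P I}) = (\<Sum>i\<in>A. M $ i $ \<alpha>)"
  proof (rule Max_eqI)
    fix y assume "y \<in> ?v ` {I. ?P I}"
    then obtain I where I: "?P I" "y = (\<Sum>i\<in>I \<alpha>. M $ i $ \<alpha>)" using val by auto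
    have "card A = card (I \<alpha>)" using I(1) by (simp add: scaled_unit_def)
    then show "y \<le> (\<Sum>i\<in>A. M $ i $ \<alpha>)"
      unfolding I(2) by (intro sum_le_sum_dominating assms) auto
  next
    show "(\<Sum>i\<in>A. M $ i $ \<alpha>) \<in> ?v ` {I. ?P I}"
      using I\<^sub>0 val[OF I\<^sub>0] by (intro image_eqI[of _ _ I\<^sub>0]) (auto simp: I\<^sub>0_def)
  qed simp
  then show ?thesis
    unfolding basic_value_def setcompr_eq_image by simp
qed

lemma coord_Phi_scaled_unit:
  fixes M :: "real^'r^'n"
  assumes "k \<le> CARD('n)"
  shows "coord (Phi M) (scaled_unit k \<alpha>) = basic_value (scaled_unit k \<alpha>) M"
proof (cases "k = 0")
  case True
  then show ?thesis
    using basic_value_scaled_unit[of "{}" M \<alpha>] by (simp add: coord_def scaled_unit_def)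
next
  case False
  have "(\<Sum>\<beta>\<in>UNIV. scaled_unit k \<alpha> \<beta>) = k"
    by (simp add: scaled_unit_def)
  then have "Rep_cidx (Abs_cidx (scaled_unit k \<alpha>) :: ('n, 'r) cidx) = scaled_unit k \<alpha>"
    using False assms by (intro Abs_cidx_inverse) simp
  moreover have "scaled_unit k \<alpha> \<noteq> (\<lambda>_. 0)"
    using False by (auto simp: scaled_unit_def fun_eq_iff)
  ultimately show ?thesis
    by (simp add: coord_def Phi_def)
qed

section \<open>Sorting columns\<close>

lemma ex_bij_antimono:
  fixes f :: "'n::{finite,linorder} \<Rightarrow> real"
  shows "\<exists>\<rho> :: 'n \<Rightarrow> 'n. bij \<rho> \<and> antimono (\<lambda>j. f (\<rho> j))"
proof -
  define xs where "xs = sort_key (\<lambda>i. - f i) (sorted_list_of_set UNIV)"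
  have xs: "set xs = UNIV" "distinct xs" "sorted (map (\<lambda>i. - f i) xs)"
    by (simp_all add: xs_def)
  then have len: "length xs = CARD('n)"
    using distinct_card by fastforce
  have lt: "card {..<j} < length xs" for j :: 'n
    unfolding len by (intro psubset_card_mono) auto
  have mono: "card {..<i} < card {..<j}" if "i < j" for i j :: 'n
    using that by (intro psubset_card_mono) auto
  have "inj (\<lambda>j :: 'n. xs ! card {..<j})"
  proof (rule injI)
    fix i j :: 'n assume "xs ! card {..<i} = xs ! card {..<j}"
    then have "card {..<i} = card {..<j}"
      using xs(2) lt by (simp add: nth_eq_iff_index_eq)
    then show "i = j"
      using mono[of i j] mono[of j i] by (cases i j rule: linorder_cases) auto
  qed
  then have "bij (\<lambda>j :: 'n. xs ! card {..<j})"
    by (simp add: bij_def finite_UNIV_inj_surj)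
  moreover have "antimono (\<lambda>j :: 'n. f (xs ! card {..<j}))"
  proof (rule antimonoI)
    fix i j :: 'n assume "i \<le> j"
    then have "card {..<i} \<le> card {..<j}" by (intro card_mono) auto
    then show "f (xs ! card {..<j}) \<le> f (xs ! card {..<i})"
      using sorted_nth_mono[OF xs(3), of "card {..<i}" "card {..<j}"] lt by simp
  qed
  ultimately show ?thesis by blast
qed

text \<open>The initial segments \<open>{..i}\<close> and \<open>{..<i}\<close> of a decreasing enumeration \<open>\<rho>\<close> of the column
  realise its largest partial sums, and they differ in the entry at \<open>\<rho> i\<close> alone.\<close>

lemma section_map_Phi:
  fixes M :: "real^'r^'n::{finite,linorder}" and \<rho> :: "'n \<Rightarrow> 'n"
  assumes \<rho>: "bij \<rho>" and anti: "antimono (\<lambda>j. M $ \<rho> j $ \<alpha>)"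
  shows "section_map (Phi M) $ i $ \<alpha> = M $ \<rho> i $ \<alpha>"
proof -
  let ?N = "\<chi> j. M $ \<rho> j"
  have partial: "coord (Phi M) (scaled_unit (card A) \<alpha>) = (\<Sum>j\<in>A. M $ \<rho> j $ \<alpha>)"
    if down: "\<And>a b. a \<in> A \<Longrightarrow> b \<notin> A \<Longrightarrow> a \<le> b" for A :: "'n set"
  proof -
    have "coord (Phi M) (scaled_unit (card A) \<alpha>) = basic_value (scaled_unit (card A) \<alpha>) ?N"
      by (simp add: coord_Phi_scaled_unit card_mono basic_value_permute_rows[OF \<rho>])
    also have "\<dots> = (\<Sum>j\<in>A. ?N $ j $ \<alpha>)"
      using down antimonoD[OF anti] by (intro basic_value_scaled_unit) simp
    finally show ?thesis by simp
  qed
  have seg: "{..i} = insert i {..<i}" by auto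
  then have "row_number i - 1 = card {..<i}"
    by (simp add: row_number_def)
  then have "section_map (Phi M) $ i $ \<alpha>
      = (\<Sum>j\<in>{..i}. M $ \<rho> j $ \<alpha>) - (\<Sum>j\<in>{..<i}. M $ \<rho> j $ \<alpha>)"
    using partial[of "{..i}"] partial[of "{..<i}"]
    by (simp add: section_map_def row_number_def)
  also have "\<dots> = M $ \<rho> i $ \<alpha>" by (simp add: seg)
  finally show ?thesis .
qed

text \<open>If \<open>\<rho> \<alpha>\<close> sorts column \<open>\<alpha>\<close>, then undoing the sorting gives \<open>M\<close> up to the common row
  permutation \<open>\<rho> (Min UNIV)\<close>, which normalises the recoupling on the first column.\<close>

lemma Phi_recouple_section_map:
  fixes M :: "real^'r::{finite,linorder}^'n::{finite,linorder}"
  shows "\<exists>\<sigma>\<in>recouplings. Phi (recouple \<sigma> (section_map (Phi M))) = Phi M"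
proof -
  obtain \<rho> :: "'r \<Rightarrow> 'n \<Rightarrow> 'n" where \<rho>: "\<And>\<alpha>. bij (\<rho> \<alpha>)" "\<And>\<alpha>. antimono (\<lambda>j. M $ \<rho> \<alpha> j $ \<alpha>)"
    using ex_bij_antimono[where f = "\<lambda>j. M $ j $ _"] by metis
  define \<pi> where "\<pi> = \<rho> (Min UNIV)"
  define \<sigma> where "\<sigma> \<alpha> = inv (\<rho> \<alpha>) \<circ> \<pi>" for \<alpha>
  have \<pi>: "bij \<pi>" using \<rho>(1) by (simp add: \<pi>_def)
  have "\<sigma> (Min UNIV) = id"
    using \<pi> by (simp add: \<sigma>_def \<pi>_def[symmetric] bij_is_inj)
  then have "\<sigma> \<in> recouplings"
    using \<pi> \<rho>(1) by (auto simp: recouplings_def \<sigma>_def intro: bij_comp bij_imp_bij_inv)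
  moreover have "recouple \<sigma> (section_map (Phi M)) = (\<chi> i. M $ \<pi> i)"
    using \<rho>(1) by (simp add: vec_eq_iff recouple_def section_map_Phi[OF \<rho>] \<sigma>_def
      surj_f_inv_f bij_is_surj)
  then have "Phi (recouple \<sigma> (section_map (Phi M))) = Phi M"
    using basic_value_permute_rows[OF \<pi>, of _ M] by (simp add: Phi_def)
  ultimately show ?thesis by blast
qed

section \<open>Discriminants\<close>

lemma discriminant_nonneg: "0 \<le> discriminant \<sigma> w"
  unfolding discriminant_def by (rule order_trans[OF abs_ge_zero]) (rule Max_ge, auto)

lemma discriminant_eq_0_iff: "discriminant \<sigma> w = 0 \<longleftrightarrow> Phi (recouple \<sigma> (section_map w)) = w"
proof -
  have "discriminant \<sigma> w = 0 \<longleftrightarrow> discriminant \<sigma> w \<le> 0"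
    using discriminant_nonneg[of \<sigma> w] by auto
  also have "\<dots> \<longleftrightarrow> (\<forall>c. w $ c = basic_value (Rep_cidx c) (recouple \<sigma> (section_map w)))"
    unfolding discriminant_def by (subst Max_le_iff) auto
  also have "\<dots> \<longleftrightarrow> Phi (recouple \<sigma> (section_map w)) = w"
    by (auto simp: Phi_def vec_eq_iff)
  finally show ?thesis .
qed

lemma recouplings_nonempty: "recouplings \<noteq> {}"
  by (auto simp: recouplings_def intro!: exI[of _ "\<lambda>_. id"])

lemma min_discriminant_nonneg: "0 \<le> min_discriminant w"
  unfolding min_discriminant_def
  by (subst Min_ge_iff) (auto simp: recouplings_nonempty discriminant_nonneg)

lemma min_discriminant_eq_0_iff:
  "min_discriminant w = 0 \<longleftrightarrow> (\<exists>\<sigma>\<in>recouplings. Phi (recouple \<sigma> (section_map w)) = w)"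
proof -
  have "min_discriminant w = 0 \<longleftrightarrow> min_discriminant w \<le> 0"
    using min_discriminant_nonneg[of w] by auto
  also have "\<dots> \<longleftrightarrow> (\<exists>\<sigma>\<in>recouplings. discriminant \<sigma> w \<le> 0)"
    unfolding min_discriminant_def by (subst Min_le_iff) (auto simp: recouplings_nonempty)
  also have "\<dots> \<longleftrightarrow> (\<exists>\<sigma>\<in>recouplings. discriminant \<sigma> w = 0)"
    using discriminant_nonneg by (metis order.antisym order.refl)
  finally show ?thesis by (simp add: discriminant_eq_0_iff)
qed

lemma range_Phi: "range Phi = {w. min_discriminant w = 0}"
  unfolding min_discriminant_eq_0_iff using Phi_recouple_section_map by (auto intro: sym)

lemma tropical_rational_coord: "tropical_rational (\<lambda>w. coord w c)"
  by (cases "c = (\<lambda>_. 0)")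
     (simp_all add: coord_def tropical_rational_polynomial tropical_polynomial_const
       tropical_polynomial_coordinate)

lemma tropical_rational_min_discriminant: "tropical_rational min_discriminant"
proof -
  have "tropical_rational (\<lambda>w. recouple \<sigma> (section_map w) $ i $ \<alpha>)" for \<sigma> i \<alpha>
    by (simp add: recouple_def section_map_def tropical_rational_diff tropical_rational_coord)
  then have "tropical_rational (discriminant \<sigma>)" for \<sigma>
    unfolding discriminant_def[abs_def]
    by (intro tropical_rational_Max tropical_rational_abs tropical_rational_diff
        tropical_rational_basic_value
        tropical_rational_polynomial[OF tropical_polynomial_coordinate]) auto
  then show ?thesis
    unfolding min_discriminant_def[abs_def]
    by (intro tropical_rational_Min recouplings_nonempty) auto
qed

theorem corollary3p7:
  shows "tropical_rational
           (min_discriminant :: real^('n::{finite,linorder}, 'r::{finite,linorder}) cidx \<Rightarrow> real)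
       \<and> (\<forall>w :: real^('n, 'r) cidx. 0 \<le> min_discriminant w)
       \<and> range (Phi :: real^'r::{finite,linorder}^'n::{finite,linorder} \<Rightarrow> real^('n, 'r) cidx) = {w. min_discriminant w = 0}
       \<and> (\<exists>\<P>. finite \<P> \<and> (\<forall>P\<in>\<P>. polyhedron P)
             \<and> range (Phi :: real^'r::{finite,linorder}^'n::{finite,linorder} \<Rightarrow> real^('n, 'r) cidx) = \<Union>\<P>)"
  unfolding range_Phi
  using tropical_rational_min_discriminant min_discriminant_nonneg
    tropical_rational_zero_set[OF tropical_rational_min_discriminant]
  by blast

end
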